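(* Let $n\ge 2$, and let $\Theta_K=\{(j,i)\mid 1\le i<j\le n\}$ and $\Theta_C=\{(i+1,i)\mid i=1,2,\dots,n-1\}$. Then for every binary relation $\Theta$ on the set $\{1,2,\dots,n\}$ such that $\Theta_C\subseteq\Theta\subseteq\Theta_K$, the set of all semigroup identities (over an alphabet $X$) holding in the Hecke--Kiselman monoid $\mathcal{HK}_\Theta$ coincides with $$J_n=\{w\bumpeq w'\mid w\sim_n w'\}.$$
   Context: Hecke--Kiselman monoids: for an integer $n\ge 2$ and an anti-reflexive binary relation $\Theta$ on $\{1,\dots,n\}$ (i.e. $(i,i)\notin\Theta$ for all $i$), $\mathcal{HK}_\Theta$ is the monoid generated by $a_1,\dots,a_n$ subject to the relations: $a_i^2=a_i$ for each $i$; $a_ia_j=a_ja_i$ if $(i,j),(j,i)\notin\Theta$; $a_ia_ja_i=a_ja_ia_j$ if $(i,j),(j,i)\in\Theta$; $a_ia_ja_i=a_ja_ia_j=a_ja_i$ if $(i,j)\notin\Theta$ and $(j,i)\in\Theta$. Identities: $X^+$ is the free semigroup and $X^*$ the free monoid over an alphabet $X$. A semigroup identity is a pair of words $u,v\in X^+$, written $u\bumpeq v$. A semigroup $S$ satisfies $u\bumpeq v$ (equivalently, $u\bumpeq v$ holds in $S$) if $u\varphi=v\varphi$ for every homomorphism $\varphi\colon X^+\to S$. Scattered subwords: a word $u=x_1\cdots x_k$ with $x_1,\dots,x_k\in X$ is a scattered subword of $v\in X^*$ if there are words $v_0,v_1,\dots,v_k\in X^*$ with $v=v_0x_1v_1\cdots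 v_{k-1}x_kv_k$. For words $w,w'\in X^*$ and $n\ge 1$, $w\sim_n w'$ means that $w$ and $w'$ have the same scattered subwords of length $\le n$. *)

theory Defs
  imports "HOL-Algebra.Group" "HOL-Library.Sublist"
begin

section \<open>Monoid presentations\<close>

inductive_set pres_cong :: "'a set \<Rightarrow> ('a list \<times> 'a list) set \<Rightarrow> ('a list \<times> 'a list) set"
  for G :: "'a set" and R :: "('a list \<times> 'a list) set" where
  base: "\<lbrakk>(u, v) \<in> R; u \<in> lists G; v \<in> lists G; p \<in> lists G; q \<in> lists G\<rbrakk>
           \<Longrightarrow> (p @ u @ q, p @ v @ q) \<in> pres_cong G R"
| refl: "u \<in> lists G \<Longrightarrow> (u, u) \<in> pres_cong G R"
| sym: "(u, v) \<in> pres_cong G R \<Longrightarrow> (v, u) \<in> pres_cong G R"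
| trans: "\<lbrakk>(u, v) \<in> pres_cong G R; (v, w) \<in> pres_cong G R\<rbrakk> \<Longrightarrow> (u, w) \<in> pres_cong G R"

text \<open>The product of two classes is a single class, by \<open>presented_monoid_mult\<close> below.\<close>

definition presented_monoid :: "'a set \<Rightarrow> ('a list \<times> 'a list) set \<Rightarrow> 'a list set monoid" where
  "presented_monoid G R =
     \<lparr>carrier = lists G // pres_cong G R,
      mult = (\<lambda>A B. \<Union>u\<in>A. \<Union>v\<in>B. pres_cong G R `` {u @ v}),
      one = pres_cong G R `` {[]}\<rparr>"

lemma pres_cong_lists:
  "(u, v) \<in> pres_cong G R \<Longrightarrow> u \<in> lists G \<and> v \<in> lists G"
  by (induction rule: pres_cong.induct) auto

lemma equiv_pres_cong: "equiv (lists G) (pres_cong G R)"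
proof (rule equivI)
  show "pres_cong G R \<subseteq> lists G \<times> lists G"
    using pres_cong_lists by fast
  show "refl_on (lists G) (pres_cong G R)"
    by (rule refl_onI) (rule pres_cong.refl)
  show "sym (pres_cong G R)"
    by (rule symI) (rule pres_cong.sym)
  show "trans (pres_cong G R)"
    by (rule transI) (rule pres_cong.trans)
qed

lemma pres_cong_context:
  assumes "(u, v) \<in> pres_cong G R" "p \<in> lists G" "q \<in> lists G"
  shows "(p @ u @ q, p @ v @ q) \<in> pres_cong G R"
  using assms
proof (induction rule: pres_cong.induct)
  case (base u v p' q')
  then show ?case
    using pres_cong.base[of u v R G "p @ p'" "q' @ q"] by simp
next
  case (refl u)
  then show ?case by (intro pres_cong.refl) auto
next
  case (sym u v)
  then show ?case by (blast intro: pres_cong.sym)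
next
  case (trans u v w)
  then show ?case by (blast intro: pres_cong.trans)
qed

lemma pres_cong_append:
  assumes "(u, u') \<in> pres_cong G R" "(v, v') \<in> pres_cong G R"
  shows "(u @ v, u' @ v') \<in> pres_cong G R"
proof -
  note l = pres_cong_lists[OF assms(1)] pres_cong_lists[OF assms(2)]
  have "(u @ v, u' @ v) \<in> pres_cong G R"
    using pres_cong_context[OF assms(1), of "[]" v] l by simp
  moreover have "(u' @ v, u' @ v') \<in> pres_cong G R"
    using pres_cong_context[OF assms(2), of u' "[]"] l by simp
  ultimately show ?thesis by (rule pres_cong.trans)
qed

lemma presented_monoid_mult:
  assumes "u \<in> lists G" "v \<in> lists G"
  shows "pres_cong G R `` {u} \<otimes>\<^bsub>presented_monoid G R\<^esub> pres_cong G R `` {v}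
           = pres_cong G R `` {u @ v}"
proof -
  have "congruent2 (pres_cong G R) (pres_cong G R) (\<lambda>u v. pres_cong G R `` {u @ v})"
    by (rule congruent2I')
      (rule equiv_class_eq[OF equiv_pres_cong], rule pres_cong_append)
  from UN_equiv_class2[OF equiv_pres_cong equiv_pres_cong this assms]
  show ?thesis by (simp add: presented_monoid_def)
qed

lemma monoid_presented_monoid: "monoid (presented_monoid G R)"
proof -
  let ?M = "presented_monoid G R"
  let ?c = "\<lambda>u. pres_cong G R `` {u}"
  have one: "\<one>\<^bsub>?M\<^esub> = ?c []"
    by (simp add: presented_monoid_def)
  have carr: "?c u \<in> carrier ?M" if "u \<in> lists G" for u
    using that by (simp add: presented_monoid_def quotientI)
  have ex: "\<exists>u\<in>lists G. x = ?c u" if "x \<in> carrier ?M" for x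
    using that by (auto simp: presented_monoid_def elim: quotientE)
  have app: "u @ v \<in> lists G" if "u \<in> lists G" "v \<in> lists G" for u v
    using that by simp
  show ?thesis
  proof (rule monoidI)
    fix x y assume "x \<in> carrier ?M" "y \<in> carrier ?M"
    then show "x \<otimes>\<^bsub>?M\<^esub> y \<in> carrier ?M"
      using ex carr app presented_monoid_mult by metis
  next
    show "\<one>\<^bsub>?M\<^esub> \<in> carrier ?M"
      using carr[of "[]"] one by simp
  next
    fix x y z assume "x \<in> carrier ?M" "y \<in> carrier ?M" "z \<in> carrier ?M"
    then obtain u v w where "u \<in> lists G" "v \<in> lists G" "w \<in> lists G"
      "x = ?c u" "y = ?c v" "z = ?c w"
      using ex by metis
    then show "x \<otimes>\<^bsub>?M\<^esub> y \<otimes>\<^bsub>?M\<^esub> z = x \<otimes>\<^bsub>?M\<^esub> (y \<otimes>\<^bsub>?M\<^esub> z)"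
      by (simp add: presented_monoid_mult app del: append_in_lists_conv)
  next
    fix x assume "x \<in> carrier ?M"
    then obtain u where "u \<in> lists G" "x = ?c u"
      using ex by metis
    then show "\<one>\<^bsub>?M\<^esub> \<otimes>\<^bsub>?M\<^esub> x = x" "x \<otimes>\<^bsub>?M\<^esub> \<one>\<^bsub>?M\<^esub> = x"
      by (simp_all add: one presented_monoid_mult)
  qed
qed


section \<open>Hecke--Kiselman monoids\<close>

text \<open>The letter \<open>i\<close> stands for the generator \<open>a\<^sub>i\<close>.\<close>

inductive_set HK_relations :: "nat \<Rightarrow> (nat \<times> nat) set \<Rightarrow> (nat list \<times> nat list) set"
  for n :: nat and \<Theta> :: "(nat \<times> nat) set" where
  idem: "i \<in> {1..n} \<Longrightarrow> ([i, i], [i]) \<in> HK_relations n \<Theta>"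
| comm: "\<lbrakk>i \<in> {1..n}; j \<in> {1..n}; (i, j) \<notin> \<Theta>; (j, i) \<notin> \<Theta>\<rbrakk>
           \<Longrightarrow> ([i, j], [j, i]) \<in> HK_relations n \<Theta>"
| braid: "\<lbrakk>i \<in> {1..n}; j \<in> {1..n}; (i, j) \<in> \<Theta>; (j, i) \<in> \<Theta>\<rbrakk>
           \<Longrightarrow> ([i, j, i], [j, i, j]) \<in> HK_relations n \<Theta>"
| arrow1: "\<lbrakk>i \<in> {1..n}; j \<in> {1..n}; (i, j) \<notin> \<Theta>; (j, i) \<in> \<Theta>\<rbrakk>
           \<Longrightarrow> ([i, j, i], [j, i, j]) \<in> HK_relations n \<Theta>"
| arrow2: "\<lbrakk>i \<in> {1..n}; j \<in> {1..n}; (i, j) \<notin> \<Theta>; (j, i) \<in> \<Theta>\<rbrakk>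
           \<Longrightarrow> ([j, i, j], [j, i]) \<in> HK_relations n \<Theta>"

definition HK_monoid :: "nat \<Rightarrow> (nat \<times> nat) set \<Rightarrow> nat list set monoid" where
  "HK_monoid n \<Theta> = presented_monoid {1..n} (HK_relations n \<Theta>)"

definition Theta_K :: "nat \<Rightarrow> (nat \<times> nat) set" where
  "Theta_K n = {(j, i) | i j. 1 \<le> i \<and> i < j \<and> j \<le> n}"

definition Theta_C :: "nat \<Rightarrow> (nat \<times> nat) set" where
  "Theta_C n = {(i + 1, i) | i. i \<in> {1..n - 1}}"


section \<open>Semigroup identities\<close>

text \<open>
  Semigroups are represented by the record type of monoids with the unit field ignored;
  the set \<^term>\<open>hom G H\<close> does not refer to units. In particular the value of \<open>one\<close>
  below is irrelevant: it does not belong to the carrier.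
\<close>

definition free_semigroup :: "'x set \<Rightarrow> 'x list monoid" where
  "free_semigroup X = \<lparr>carrier = lists X - {[]}, mult = (@), one = []\<rparr>"

definition satisfies_identity ::
  "'x set \<Rightarrow> ('s, 'm) monoid_scheme \<Rightarrow> 'x list \<Rightarrow> 'x list \<Rightarrow> bool" where
  "satisfies_identity X S u v \<longleftrightarrow> (\<forall>\<phi> \<in> hom (free_semigroup X) S. \<phi> u = \<phi> v)"

definition identities_of :: "'x set \<Rightarrow> ('s, 'm) monoid_scheme \<Rightarrow> ('x list \<times> 'x list) set" where
  "identities_of X S =
     {(u, v). u \<in> carrier (free_semigroup X) \<and> v \<in> carrier (free_semigroup X)
        \<and> satisfies_identity X S u v}"

definition scattered_equiv :: "nat \<Rightarrow> 'x list \<Rightarrow> 'x list \<Rightarrow> bool" where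
  "scattered_equiv n w w' \<longleftrightarrow>
     {u. subseq u w \<and> length u \<le> n} = {u. subseq u w' \<and> length u \<le> n}"

definition J_identities :: "'x set \<Rightarrow> nat \<Rightarrow> ('x list \<times> 'x list) set" where
  "J_identities X n =
     {(w, w'). w \<in> carrier (free_semigroup X) \<and> w' \<in> carrier (free_semigroup X)
        \<and> scattered_equiv n w w'}"

end

theory Submission
  imports Defs
begin

text \<open>
  Why the theorem holds. Call the set of strictly decreasing scattered subwords of a word over
  \<open>{1..n}\<close> its shadow. Two facts connect shadows with the monoids in question.

  If \<open>\<Theta> \<subseteq> Theta_K n\<close>, two words with the same shadow represent the same element of the
  Hecke--Kiselman monoid (\<open>shadow_determines_class\<close>). For \<open>i < j\<close> the relations give
  \<open>a\<^sub>i a\<^sub>j a\<^sub>i = a\<^sub>j a\<^sub>i = a\<^sub>j a\<^sub>i a\<^sub>j\<close>, so an \<open>i\<close> may be inserted whenever an earlier \<open>i\<close> is separated from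
  it by smaller letters only, or a later \<open>i\<close> by larger letters only. An insertion that leaves the
  shadow unchanged is always a consequence of such moves (\<open>insert_letter\<close>), and two words with the
  same shadow can be completed to a common word by insertions that leave the shadow unchanged
  (\<open>shadow_determines_class_prefix\<close>).
  A decreasing word over \<open>{1..n}\<close> has length at most \<open>n\<close>, so under a substitution of words for
  letters it meets at most \<open>n\<close> of the substituted blocks. Therefore \<open>w \<sim>\<^sub>n w'\<close> forces the
  images of \<open>w\<close> and \<open>w'\<close> to have the same shadow, and \<open>w \<bumpeq> w'\<close> holds in the monoid.

  If \<open>Theta_C n \<subseteq> \<Theta> \<subseteq> Theta_K n\<close>, the Hecke--Kiselman monoid acts on \<open>{0..n}\<close>, the generator
  \<open>a\<^sub>i\<close> sending \<open>i\<close> to \<open>i - 1\<close> and fixing every other state; these are the generators of the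
  Catalan monoid. Attach to the letters of a word \<open>t\<close> of length \<open>k \<le> n\<close>, from left to right, the
  generators \<open>a\<^sub>k, \<dots>, a\<^sub>1\<close>, and substitute for a letter \<open>x\<close> the product, in increasing order, of the
  generators attached to the occurrences of \<open>x\<close> in \<open>t\<close>. Started in the state \<open>k\<close>, the action then
  performs the greedy search for \<open>t\<close> as a scattered subword: the state is the number of letters
  of \<open>t\<close> still to be found (\<open>fold_catalan_step_search\<close>). Hence the two sides of an identity of the
  monoid have the same scattered subwords of length at most \<open>n\<close>.
\<close>

section \<open>Scattered subwords\<close>

lemma subseq_append_letter_cases:
  assumes "subseq (\<alpha> @ x # \<beta>) (p @ q)"
  shows "subseq (\<alpha> @ [x]) p \<or> subseq (x # \<beta>) q"
proof -
  from assms obtain \<gamma> \<delta> where eq: "\<alpha> @ x # \<beta> = \<gamma> @ \<delta>" and sub: "subseq \<gamma> p" "subseq \<delta> q"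
    by (auto simp: subseq_append_iff)
  from eq have "(\<exists>\<epsilon>. \<gamma> = (\<alpha> @ [x]) @ \<epsilon>) \<or> (\<exists>\<epsilon>. \<delta> = \<epsilon> @ x # \<beta>)"
    by (auto simp: append_eq_append_conv2 Cons_eq_append_conv)
  then show ?thesis
  proof
    assume "\<exists>\<epsilon>. \<gamma> = (\<alpha> @ [x]) @ \<epsilon>"
    then show ?thesis
      using sub(1) by (metis subseq_order.order_trans subseq_rev_drop_many subseq_order.refl)
  next
    assume "\<exists>\<epsilon>. \<delta> = \<epsilon> @ x # \<beta>"
    then show ?thesis
      using sub(2) by (metis subseq_order.order_trans list_emb_append2 subseq_order.refl)
  qed
qed

lemma subseq_snoc_skip:
  assumes "subseq (\<beta> @ [i]) (p @ q)" "i \<notin> set q"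
  shows "subseq (\<beta> @ [i]) p"
  using subseq_append_letter_cases[of \<beta> i "[]" p q] assms by (auto simp: subseq_singleton_left)

lemma subseq_imp_subseq_rev: "subseq xs ys \<Longrightarrow> subseq (rev xs) (rev ys)"
  by (induction rule: list_emb.induct) (auto intro: list_emb_append_mono)

lemma subseq_set: "subseq xs ys \<Longrightarrow> set xs \<subseteq> set ys"
  by (induction rule: list_emb.induct) auto

lemma concat_map_in_lists:
  "(\<And>x. x \<in> set u \<Longrightarrow> \<rho> x \<in> lists G) \<Longrightarrow> concat (map \<rho> u) \<in> lists G"
  by (induction u) auto

lemma subseq_concat_map_mono: "subseq u w \<Longrightarrow> subseq (concat (map \<rho> u)) (concat (map \<rho> w))"
  by (induction rule: list_emb.induct) (auto intro: list_emb_append_mono)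

text \<open>
  Each letter of \<open>d\<close> lies in some block, so only \<open>length d\<close> many blocks are used.
\<close>

lemma subseq_concat_map_witness:
  assumes "subseq d (concat (map \<rho> w))"
  shows "\<exists>u. subseq u w \<and> length u \<le> length d \<and> subseq d (concat (map \<rho> u))"
  using assms
proof (induction w arbitrary: d)
  case Nil
  then show ?case by (intro exI[of _ "[]"]) simp
next
  case (Cons x w)
  then obtain d1 d2 where d: "d = d1 @ d2" "subseq d1 (\<rho> x)" "subseq d2 (concat (map \<rho> w))"
    by (auto simp: subseq_append_iff)
  from Cons.IH[OF d(3)] obtain u where u: "subseq u w" "length u \<le> length d2"
    "subseq d2 (concat (map \<rho> u))" by blast
  show ?case
  proof (cases "d1 = []")
    case True
    then show ?thesis using u d by auto
  next
    case False
    then have "length (x # u) \<le> length d"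
      using u(2) unfolding d(1) by (cases d1) auto
    moreover have "subseq d (concat (map \<rho> (x # u)))"
      using d u by (auto intro: list_emb_append_mono)
    moreover have "subseq (x # u) (x # w)" using u by simp
    ultimately show ?thesis by blast
  qed
qed


section \<open>Shadows determine elements\<close>

text \<open>
  The order is a parameter rather than a type class so that the locale can be interpreted in
  the dual situation, where words are reversed and the order is inverted.
\<close>

locale kiselman_congruence =
  fixes G :: "'a set" and E :: "('a list \<times> 'a list) set"
    and lt :: "'a \<Rightarrow> 'a \<Rightarrow> bool" (infix "\<prec>" 50)
  assumes equiv: "equiv (lists G) E"
    and append: "(u, u') \<in> E \<Longrightarrow> (v, v') \<in> E \<Longrightarrow> (u @ v, u' @ v') \<in> E"
    and lt_trans: "x \<prec> y \<Longrightarrow> y \<prec> z \<Longrightarrow> x \<prec> z"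
    and lt_irrefl: "\<not> x \<prec> x"
    and lt_total: "x \<noteq> y \<Longrightarrow> x \<prec> y \<or> y \<prec> x"
    and idem: "i \<in> G \<Longrightarrow> ([i, i], [i]) \<in> E"
    and absorb_lower: "i \<in> G \<Longrightarrow> j \<in> G \<Longrightarrow> i \<prec> j \<Longrightarrow> ([i, j, i], [j, i]) \<in> E"
    and absorb_upper: "i \<in> G \<Longrightarrow> j \<in> G \<Longrightarrow> i \<prec> j \<Longrightarrow> ([j, i, j], [j, i]) \<in> E"
begin

abbreviation decreasing :: "'a list \<Rightarrow> bool" where
  "decreasing \<equiv> sorted_wrt (\<lambda>x y. y \<prec> x)"

definition shadow :: "'a list \<Rightarrow> 'a list set" where
  "shadow u = {d. decreasing d \<and> subseq d u}"

lemma E_refl: "u \<in> lists G \<Longrightarrow> (u, u) \<in> E"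
  using equiv by (auto simp: equiv_def refl_on_def)

lemma E_sym: "(u, v) \<in> E \<Longrightarrow> (v, u) \<in> E"
  using equiv by (auto simp: equiv_def sym_def)

lemma E_trans [trans]: "(u, v) \<in> E \<Longrightarrow> (v, w) \<in> E \<Longrightarrow> (u, w) \<in> E"
  using equiv by (auto simp: equiv_def trans_def)

lemma E_context:
  assumes "(u, v) \<in> E" "p \<in> lists G" "q \<in> lists G"
  shows "(p @ u @ q, p @ v @ q) \<in> E"
  using assms by (intro append E_refl)

lemma absorb_after_smaller:
  assumes "i \<in> G" "set q \<subseteq> G" "\<And>x. x \<in> set q \<Longrightarrow> \<not> i \<prec> x"
  shows "(i # q @ [i], i # q) \<in> E"
  using assms(2,3)
proof (induction q)
  case Nil
  show ?case using idem[OF assms(1)] by simp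
next
  case (Cons y q)
  then have IH: "(i # q @ [i], i # q) \<in> E" and y: "y \<in> G" "\<not> i \<prec> y" and q: "q \<in> lists G"
    by auto
  show ?case
  proof (cases "y = i")
    case True
    then show ?thesis
      using E_context[OF IH, of "[i]" "[]"] assms(1) by simp
  next
    case False
    then have "y \<prec> i" using y lt_total by blast
    then have iy: "([i, y, i], [i, y]) \<in> E"
      using absorb_upper y assms(1) by blast
    have "(i # y # q @ [i], i # y # i # q @ [i]) \<in> E"
      using E_context[OF E_sym[OF iy], of "[]" "q @ [i]"] q assms(1) by simp
    also have "(i # y # i # q @ [i], i # y # i # q) \<in> E"
      using E_context[OF IH, of "[i, y]" "[]"] assms(1) y by simp
    also have "(i # y # i # q, i # y # q) \<in> E"
      using E_context[OF iy, of "[]" q] q by simp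
    finally show ?thesis by simp
  qed
qed

text \<open>
  If some \<open>i\<close> in \<open>p\<close> has no larger letter behind it, it absorbs the new one. Otherwise write
  \<open>p = p1 b p2\<close>, where \<open>b\<close> is the last letter of \<open>p\<close> larger than \<open>i\<close> and \<open>p2\<close> is free of \<open>i\<close>. If
  \<open>b\<close> completed some word \<open>\<alpha>\<close> of letters larger than \<open>b\<close> to a decreasing word \<open>\<alpha> b\<close> that is not
  present in \<open>p1\<close>, then \<open>\<alpha> b\<close> would violate the hypothesis. So \<open>p1\<close> and \<open>b\<close> satisfy
  the same hypothesis, \<open>b\<close> can be erased from \<open>p\<close> by induction, and the claim for \<open>p1 p2\<close> remains.
\<close>

lemma append_letter:
  assumes "p \<in> lists G" "i \<in> G"
    and "\<And>\<alpha>. decreasing \<alpha> \<Longrightarrow> (\<And>a. a \<in> set \<alpha> \<Longrightarrow> i \<prec> a) \<Longrightarrow> subseq \<alpha> p \<Longrightarrow> subseq (\<alpha> @ [i]) p"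
  shows "(p @ [i], p) \<in> E"
  using assms
proof (induction "length p" arbitrary: p i rule: less_induct)
  case less
  note hyp = less.prems(3)
  have absorbed: ?case if "p = p3 @ i # p4" "\<And>x. x \<in> set p4 \<Longrightarrow> \<not> i \<prec> x" for p3 p4
    using E_context[OF absorb_after_smaller[of i p4], of p3 "[]"] that less.prems(1,2) by auto
  show ?case
  proof (cases "\<exists>b\<in>set p. i \<prec> b")
    case False
    have "i \<in> set p"
      using hyp[of "[]"] by (simp add: subseq_singleton_left)
    then show ?thesis
      using absorbed False by (metis Un_iff in_set_conv_decomp list.set_intros(2) set_append)
  next
    case True
    then obtain p1 b p2 where p: "p = p1 @ b # p2" and b: "i \<prec> b"
      and p2: "\<And>x. x \<in> set p2 \<Longrightarrow> \<not> i \<prec> x"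
      using split_list_last_prop[of p "\<lambda>b. i \<prec> b"] by blast
    show ?thesis
    proof (cases "i \<in> set p2")
      case True
      then obtain p3 p4 where "p2 = p3 @ i # p4" by (meson split_list)
      then show ?thesis
        using absorbed[of "p1 @ b # p3" p4] p p2 by auto
    next
      case False
      have ib: "i \<noteq> b" using b lt_irrefl by blast
      have into_p1: "subseq (\<alpha> @ [i]) p1" if "subseq (\<alpha> @ [i]) p" for \<alpha>
        using subseq_snoc_skip[of \<alpha> i p1 "b # p2"] that False ib unfolding p by simp
      have "(p1 @ [b], p1) \<in> E"
      proof (rule less.hyps)
        show "length p1 < length p" "p1 \<in> lists G" "b \<in> G"
          using less.prems(1) by (auto simp: p)
        fix \<alpha> assume \<alpha>: "decreasing \<alpha>" "\<And>a. a \<in> set \<alpha> \<Longrightarrow> b \<prec> a" "subseq \<alpha> p1"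
        have "subseq (\<alpha> @ [b]) (p1 @ b # p2)"
          using \<alpha>(3) by (intro list_emb_append_mono) auto
        then have "subseq ((\<alpha> @ [b]) @ [i]) p"
          using \<alpha> b lt_trans by (intro hyp) (auto simp: sorted_wrt_append p)
        then show "subseq (\<alpha> @ [b]) p1"
          using into_p1[of "\<alpha> @ [b]"]
          by (metis subseq_order.order_trans subseq_rev_drop_many subseq_order.refl)
      qed
      from E_context[OF this, of "[]"] have erase: "(p1 @ b # q, p1 @ q) \<in> E" if "q \<in> lists G" for q
        using that by simp
      have "((p1 @ p2) @ [i], p1 @ p2) \<in> E"
      proof (rule less.hyps)
        show "length (p1 @ p2) < length p" "p1 @ p2 \<in> lists G" "i \<in> G"
          using less.prems(1,2) by (auto simp: p)
        fix \<alpha> assume \<alpha>: "decreasing \<alpha>" "\<And>a. a \<in> set \<alpha> \<Longrightarrow> i \<prec> a" "subseq \<alpha> (p1 @ p2)"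
        have "subseq (p1 @ p2) p"
          unfolding p by (intro list_emb_append_mono) auto
        then have "subseq (\<alpha> @ [i]) p"
          using \<alpha> by (intro hyp) (auto intro: subseq_order.order_trans)
        from into_p1[OF this] show "subseq (\<alpha> @ [i]) (p1 @ p2)"
          by (rule subseq_rev_drop_many)
      qed
      then have short: "(p1 @ p2 @ [i], p1 @ p2) \<in> E" by simp
      have "p2 \<in> lists G" using less.prems(1) by (simp add: p)
      then have "(p1 @ b # p2 @ [i], p1 @ b # p2) \<in> E"
        using E_trans[OF E_trans[OF erase[of "p2 @ [i]"] short] E_sym[OF erase[of p2]]] less.prems(2)
        by simp
      then show ?thesis by (simp add: p)
    qed
  qed
qed

lemma dual: "kiselman_congruence G {(u, v). (rev u, rev v) \<in> E} (\<lambda>x y. y \<prec> x)"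
proof
  show "equiv (lists G) {(u, v). (rev u, rev v) \<in> E}"
  proof (rule equivI)
    show "{(u, v). (rev u, rev v) \<in> E} \<subseteq> lists G \<times> lists G"
      using equiv_type[OF equiv] by auto
    show "refl_on (lists G) {(u, v). (rev u, rev v) \<in> E}"
      by (rule refl_onI) (auto intro: E_refl)
    show "sym {(u, v). (rev u, rev v) \<in> E}"
      by (rule symI) (simp add: E_sym)
    show "trans {(u, v). (rev u, rev v) \<in> E}"
      by (rule transI) (simp, rule E_trans)
  qed
qed (simp_all add: append lt_irrefl idem absorb_lower absorb_upper,
    (blast intro: lt_trans dest: lt_total)+)

lemma prepend_letter:
  assumes "q \<in> lists G" "i \<in> G"
    and "\<And>\<beta>. decreasing \<beta> \<Longrightarrow> (\<And>b. b \<in> set \<beta> \<Longrightarrow> b \<prec> i) \<Longrightarrow> subseq \<beta> q \<Longrightarrow> subseq (i # \<beta>) q"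
  shows "(i # q, q) \<in> E"
proof -
  interpret dual: kiselman_congruence G "{(u, v). (rev u, rev v) \<in> E}" "\<lambda>x y. y \<prec> x"
    by (rule dual)
  have "(rev q @ [i], rev q) \<in> {(u, v). (rev u, rev v) \<in> E}"
  proof (rule dual.append_letter)
    fix \<alpha> assume "dual.decreasing \<alpha>" "\<And>a. a \<in> set \<alpha> \<Longrightarrow> a \<prec> i" "subseq \<alpha> (rev q)"
    then have "subseq (i # rev \<alpha>) q"
      using subseq_imp_subseq_rev[of \<alpha> "rev q"] by (intro assms(3)) (auto simp: sorted_wrt_rev)
    then show "subseq (\<alpha> @ [i]) (rev q)"
      using subseq_imp_subseq_rev[of "i # rev \<alpha>" q] by simp
  qed (use assms in auto)
  then show ?thesis by simp
qed

text \<open>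
  If neither \<open>append_letter\<close> for \<open>p\<close> nor \<open>prepend_letter\<close> for \<open>q\<close> applies, there are decreasing
  words \<open>\<alpha>\<close> in \<open>p\<close> and \<open>\<beta>\<close> in \<open>q\<close>, with letters larger and smaller than \<open>i\<close>, such that \<open>\<alpha> i\<close> is not
  in \<open>p\<close> and \<open>i \<beta>\<close> is not in \<open>q\<close>. Then the insertion creates the decreasing word \<open>\<alpha> i \<beta>\<close>.
\<close>

lemma insert_letter:
  assumes "p \<in> lists G" "q \<in> lists G" "i \<in> G" "shadow (p @ i # q) \<subseteq> shadow (p @ q)"
  shows "(p @ i # q, p @ q) \<in> E"
proof (cases "(p @ [i], p) \<in> E")
  case True
  then show ?thesis using E_context[of "p @ [i]" p "[]" q] assms by simp
next
  case False
  then obtain \<alpha> where \<alpha>: "decreasing \<alpha>" "\<And>a. a \<in> set \<alpha> \<Longrightarrow> i \<prec> a" "subseq \<alpha> p"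
    "\<not> subseq (\<alpha> @ [i]) p"
    using append_letter[OF assms(1,3)] by blast
  have "(i # q, q) \<in> E"
  proof (rule prepend_letter)
    fix \<beta> assume \<beta>: "decreasing \<beta>" "\<And>b. b \<in> set \<beta> \<Longrightarrow> b \<prec> i" "subseq \<beta> q"
    have "subseq (\<alpha> @ i # \<beta>) (p @ i # q)"
      using \<alpha>(3) \<beta>(3) by (intro list_emb_append_mono) auto
    moreover have "b \<prec> a" if "a \<in> set \<alpha>" "b \<in> set \<beta>" for a b
      using \<alpha>(2)[OF that(1)] \<beta>(2)[OF that(2)] lt_trans by blast
    ultimately have "\<alpha> @ i # \<beta> \<in> shadow (p @ i # q)"
      using \<alpha>(1,2) \<beta>(1,2) by (auto simp: shadow_def sorted_wrt_append)
    then have "subseq (\<alpha> @ i # \<beta>) (p @ q)" using assms(4) by (auto simp: shadow_def)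
    then show "subseq (i # \<beta>) q" using subseq_append_letter_cases[of \<alpha> i \<beta> p q] \<alpha>(4) by simp
  qed (use assms in auto)
  then show ?thesis using E_context[of "i # q" q p "[]"] assms by simp
qed

lemma new_shadow_witness:
  assumes "\<not> shadow (p @ y # q) \<subseteq> shadow (p @ q)"
  obtains \<alpha> \<beta> where "decreasing (\<alpha> @ y # \<beta>)" "subseq \<alpha> p" "subseq \<beta> q"
    "\<not> subseq (\<alpha> @ y # \<beta>) (p @ q)" "\<not> subseq (\<alpha> @ [y]) p"
proof -
  obtain d where d: "decreasing d" "subseq d (p @ y # q)" "\<not> subseq d (p @ q)"
    using assms by (auto simp: shadow_def)
  obtain \<alpha> \<delta> where s: "d = \<alpha> @ \<delta>" "subseq \<alpha> p" "subseq \<delta> (y # q)"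
    using d(2) by (auto simp: subseq_append_iff)
  have "\<not> subseq \<delta> q" using d(3) s by (auto intro: list_emb_append_mono)
  then obtain \<beta> where \<beta>: "\<delta> = y # \<beta>" "subseq \<beta> q"
    using s(3) by (cases \<delta>) (auto split: if_splits)
  have "\<not> subseq (\<alpha> @ [y]) p"
    using list_emb_append_mono[of "(=)" "\<alpha> @ [y]" p \<beta> q] d(3) s(1) \<beta> by auto
  then show ?thesis using that d s \<beta> by simp
qed

text \<open>
  Suppose that both insertions create new decreasing words, \<open>\<alpha> y \<beta>\<close> and \<open>\<alpha>' x \<beta>'\<close>. The letters of
  \<open>\<beta>'\<close> are smaller than \<open>x\<close> and hence than \<open>y\<close>, so \<open>\<beta>'\<close> is a subword of \<open>v\<close>. Then \<open>\<alpha> y \<beta>'\<close> is a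
  decreasing subword of \<open>p y v\<close>, hence of \<open>p x u\<close>. Since \<open>\<alpha> y\<close> is not a subword of \<open>p\<close>, this puts
  \<open>\<beta>'\<close> into \<open>u\<close>, so \<open>\<alpha>' x \<beta>'\<close> is a subword of \<open>p x u\<close> and therefore was not new.
\<close>

lemma competing_insertions_less:
  assumes eq: "shadow (p @ x # u) = shadow (p @ y # v)" and "x \<prec> y"
  shows "shadow (p @ y # x # u) \<subseteq> shadow (p @ x # u) \<or>
         shadow (p @ x # y # v) \<subseteq> shadow (p @ y # v)"
proof (rule ccontr)
  assume "\<not> ?thesis"
  then have n1: "\<not> shadow (p @ y # x # u) \<subseteq> shadow (p @ x # u)"
    and n2: "\<not> shadow (p @ x # y # v) \<subseteq> shadow (p @ y # v)" by auto
  from n1 obtain \<alpha> \<beta> where a: "decreasing (\<alpha> @ y # \<beta>)" "subseq \<alpha> p" "\<not> subseq (\<alpha> @ [y]) p"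
    by (rule new_shadow_witness)
  from n2 obtain \<alpha>' \<beta>' where b: "decreasing (\<alpha>' @ x # \<beta>')" "subseq \<alpha>' p" "subseq \<beta>' (y # v)"
    "\<not> subseq (\<alpha>' @ x # \<beta>') (p @ y # v)"
    by (rule new_shadow_witness)
  have xy: "x \<noteq> y" using assms(2) lt_irrefl by blast
  have transfer: "subseq d (p @ x # u) \<longleftrightarrow> subseq d (p @ y # v)" if "decreasing d" for d
    using eq that by (auto simp: shadow_def)
  have small: "b \<prec> x" if "b \<in> set \<beta>'" for b
    using b(1) that by (auto simp: sorted_wrt_append)
  then have "y \<notin> set \<beta>'" using assms(2) lt_trans lt_irrefl by blast
  then have \<beta>'v: "subseq \<beta>' v"
    using b(3) by (cases \<beta>') (auto split: if_splits)
  have big: "y \<prec> a" if "a \<in> set \<alpha>" for a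
    using a(1) that by (auto simp: sorted_wrt_append)
  have small': "b \<prec> y" if "b \<in> set \<beta>'" for b
    using small[OF that] assms(2) lt_trans by blast
  have dec: "decreasing (\<alpha> @ y # \<beta>')"
    using a(1) b(1) big small' lt_trans[OF small' big] by (auto simp: sorted_wrt_append)
  have "subseq (\<alpha> @ y # \<beta>') (p @ y # v)"
    using a(2) \<beta>'v by (intro list_emb_append_mono) auto
  then have "subseq (\<alpha> @ y # \<beta>') (p @ x # u)" using transfer[OF dec] by simp
  from subseq_append_letter_cases[OF this] have "subseq (y # \<beta>') (x # u)"
    using a(3) by simp
  then have "subseq (y # \<beta>') u" using xy by simp
  then have \<beta>'u: "subseq \<beta>' u" by (rule subseq_Cons')
  have "subseq (\<alpha>' @ x # \<beta>') (p @ x # u)"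
    using b(2) \<beta>'u by (intro list_emb_append_mono) auto
  then show False using transfer[OF b(1)] b(4) by simp
qed

lemma competing_insertions:
  assumes "shadow (p @ x # u) = shadow (p @ y # v)" "x \<noteq> y"
  shows "shadow (p @ y # x # u) \<subseteq> shadow (p @ x # u) \<or>
         shadow (p @ x # y # v) \<subseteq> shadow (p @ y # v)"
  using lt_total[OF assms(2)] competing_insertions_less assms(1) by metis

lemma shadow_mono: "subseq u v \<Longrightarrow> shadow u \<subseteq> shadow v"
  by (auto simp: shadow_def intro: subseq_order.order_trans)

lemma shadow_insert: "shadow (p @ q) \<subseteq> shadow (p @ y # q)"
  by (intro shadow_mono list_emb_append_mono) auto

lemma insert_erase:
  assumes "shadow (p @ y # u) \<subseteq> shadow (p @ u)" "p \<in> lists G" "u \<in> lists G" "y \<in> G"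
    and "(p @ y # u, w) \<in> E"
  shows "(p @ u, w) \<in> E"
  using E_trans[OF E_sym[OF insert_letter] assms(5)] assms(1-4) by blast

text \<open>
  The two words are made equal from left to right: \<open>p\<close> is their common prefix. If \<open>u\<close> and \<open>v\<close>
  begin with different letters, one of these can be inserted into the other word behind \<open>p\<close> by
  \<open>competing_insertions\<close>; if one of \<open>u\<close> and \<open>v\<close> is empty, the first letter of the other can be
  inserted. Each time \<open>p\<close> grows, while the letters left in \<open>u\<close> and \<open>v\<close> become fewer.
\<close>

lemma shadow_determines_class_prefix:
  assumes "p \<in> lists G" "u \<in> lists G" "v \<in> lists G" "shadow (p @ u) = shadow (p @ v)"
  shows "(p @ u, p @ v) \<in> E"
  using assms
proof (induction "length u + length v" arbitrary: p u v rule: less_induct)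
  case less
  have left: ?case if v: "v = y # v'" and sub: "shadow (p @ y # u) \<subseteq> shadow (p @ u)" for y v'
  proof -
    have "shadow (p @ y # u) = shadow (p @ u)" using sub shadow_insert by blast
    then have "((p @ [y]) @ u, (p @ [y]) @ v') \<in> E"
      using less.prems v by (intro less.hyps) auto
    then show ?thesis
      using insert_erase[OF sub, of "p @ v"] less.prems v by simp
  qed
  have right: ?case if u: "u = x # u'" and sub: "shadow (p @ x # v) \<subseteq> shadow (p @ v)" for x u'
  proof -
    have "shadow (p @ x # v) = shadow (p @ v)" using sub shadow_insert by blast
    then have "((p @ [x]) @ u', (p @ [x]) @ v) \<in> E"
      using less.prems u by (intro less.hyps) auto
    then have "(p @ x # v, p @ u) \<in> E" using E_sym u by simp
    then show ?thesis
      using E_sym[OF insert_erase[OF sub]] less.prems u by simp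
  qed
  show ?case
  proof (cases u)
    case Nil
    show ?thesis
    proof (cases v)
      case Nil
      then show ?thesis using \<open>u = []\<close> less.prems by (simp add: E_refl)
    next
      case (Cons y v')
      have "shadow (p @ [y]) \<subseteq> shadow (p @ y # v')"
        by (intro shadow_mono list_emb_append_mono) auto
      then have "shadow (p @ [y]) \<subseteq> shadow (p @ v)" using Cons by simp
      then have "shadow (p @ y # u) \<subseteq> shadow (p @ u)"
        unfolding less.prems(4) using \<open>u = []\<close> by simp
      with Cons show ?thesis by (rule left)
    qed
  next
    case (Cons x u')
    note u = this
    show ?thesis
    proof (cases v)
      case Nil
      have "shadow (p @ [x]) \<subseteq> shadow (p @ x # u')"
        by (intro shadow_mono list_emb_append_mono) auto
      then have "shadow (p @ [x]) \<subseteq> shadow (p @ u)" using u by simp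
      then have "shadow (p @ x # v) \<subseteq> shadow (p @ v)"
        unfolding less.prems(4) using Nil by simp
      with u show ?thesis by (rule right)
    next
      case (Cons y v')
      show ?thesis
      proof (cases "x = y")
        case True
        have "((p @ [x]) @ u', (p @ [x]) @ v') \<in> E"
          using less.prems True u Cons by (intro less.hyps) auto
        then show ?thesis using True u Cons by simp
      next
        case False
        have "shadow (p @ x # u') = shadow (p @ y # v')"
          using less.prems(4) u Cons by simp
        from competing_insertions[OF this False]
        have "shadow (p @ y # u) \<subseteq> shadow (p @ u) \<or> shadow (p @ x # v) \<subseteq> shadow (p @ v)"
          using u Cons by simp
        then show ?thesis using left[OF Cons] right[OF u] by blast
      qed
    qed
  qed
qed

theorem shadow_determines_class:
  assumes "u \<in> lists G" "v \<in> lists G" "shadow u = shadow v"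
  shows "(u, v) \<in> E"
  using shadow_determines_class_prefix[of "[]" u v] assms by simp

end


section \<open>Hecke--Kiselman monoids below the Kiselman monoid\<close>

text \<open>
  Pairs of generators outside \<open>\<Theta>\<close> commute, and for commuting idempotents the two absorption laws
  hold as well.
\<close>

lemma kiselman_congruence_HK:
  assumes "\<Theta> \<subseteq> Theta_K n"
  shows "kiselman_congruence {1..n} (pres_cong {1..n} (HK_relations n \<Theta>))
    ((<) :: nat \<Rightarrow> nat \<Rightarrow> bool)"
proof -
  let ?G = "{1..n}" and ?E = "pres_cong {1..n} (HK_relations n \<Theta>)"
  have rel: "(p @ u @ q, p @ v @ q) \<in> ?E"
    if "(u, v) \<in> HK_relations n \<Theta>" "u \<in> lists ?G" "v \<in> lists ?G" "p \<in> lists ?G" "q \<in> lists ?G"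
    for p q u v
    using that by (intro pres_cong.base)
  have idem: "([i, i], [i]) \<in> ?E" if "i \<in> ?G" for i
    using rel[of "[i, i]" "[i]" "[]" "[]"] HK_relations.idem that by auto
  have absorb: "([i, j, i], [j, i]) \<in> ?E \<and> ([j, i, j], [j, i]) \<in> ?E"
    if G: "i \<in> ?G" "j \<in> ?G" and less: "i < j" for i j
  proof (cases "(j, i) \<in> \<Theta>")
    case True
    moreover have "(i, j) \<notin> \<Theta>" using assms less by (auto simp: Theta_K_def)
    ultimately have 1: "([i, j, i], [j, i, j]) \<in> ?E" and 2: "([j, i, j], [j, i]) \<in> ?E"
      using rel[of "[i, j, i]" "[j, i, j]" "[]" "[]"] rel[of "[j, i, j]" "[j, i]" "[]" "[]"]
        HK_relations.arrow1 HK_relations.arrow2 G by auto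
    show ?thesis using pres_cong.trans[OF 1 2] 2 by blast
  next
    case False
    moreover have "(i, j) \<notin> \<Theta>" using assms less by (auto simp: Theta_K_def)
    ultimately have c: "([i, j], [j, i]) \<in> HK_relations n \<Theta>"
      using HK_relations.comm G by blast
    have "([i, j, i], [j, i, i]) \<in> ?E" "([j, i, j], [j, j, i]) \<in> ?E"
      using rel[OF c, of "[]" "[i]"] rel[OF c, of "[j]" "[]"] G by auto
    moreover have "([j, i, i], [j, i]) \<in> ?E" "([j, j, i], [j, i]) \<in> ?E"
      using pres_cong_context[OF idem[OF G(1)], of "[j]" "[]"]
        pres_cong_context[OF idem[OF G(2)], of "[]" "[i]"] G by auto
    ultimately show ?thesis by (blast intro: pres_cong.trans)
  qed
  show ?thesis
    using absorb idem
    by unfold_locales (auto intro: equiv_pres_cong pres_cong_append)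
qed

lemma length_decreasing_le:
  assumes "sorted_wrt (\<lambda>x y. y < x) d" "set d \<subseteq> {1..n :: nat}"
  shows "length d \<le> n"
proof -
  have "distinct d"
    using assms(1) by (induction d) auto
  then show ?thesis
    using card_mono[OF _ assms(2)] by (simp add: distinct_card)
qed

text \<open>
  A decreasing subword of the image of \<open>w\<close> already occurs in the image of a subword of \<open>w\<close> of
  length at most \<open>n\<close>, and \<open>w'\<close> contains that subword as well.
\<close>

lemma HK_scattered_equiv_imp_cong:
  fixes \<rho> :: "'x \<Rightarrow> nat list"
  assumes "\<Theta> \<subseteq> Theta_K n" "scattered_equiv n w w'"
    and \<rho>: "\<And>x. x \<in> set w \<union> set w' \<Longrightarrow> \<rho> x \<in> lists {1..n}"
  shows "(concat (map \<rho> w), concat (map \<rho> w')) \<in> pres_cong {1..n} (HK_relations n \<Theta>)"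
proof -
  interpret kiselman_congruence "{1..n}" "pres_cong {1..n} (HK_relations n \<Theta>)"
    "(<) :: nat \<Rightarrow> nat \<Rightarrow> bool"
    by (rule kiselman_congruence_HK) fact
  have sub: "shadow (concat (map \<rho> v)) \<subseteq> shadow (concat (map \<rho> v'))"
    if eq: "scattered_equiv n v v'" and G: "concat (map \<rho> v) \<in> lists {1..n}" for v v'
  proof
    fix d assume "d \<in> shadow (concat (map \<rho> v))"
    then have d: "decreasing d" "subseq d (concat (map \<rho> v))" by (auto simp: shadow_def)
    from G have "set d \<subseteq> {1..n}"
      using subseq_set[OF d(2)] by (meson in_listsD subset_iff)
    then have "length d \<le> n" using length_decreasing_le d(1) by blast
    moreover obtain u where u: "subseq u v" "length u \<le> length d" "subseq d (concat (map \<rho> u))"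
      using subseq_concat_map_witness[OF d(2)] by blast
    ultimately have "subseq u v \<and> length u \<le> n" by simp
    then have "subseq u v'" using eq unfolding scattered_equiv_def by blast
    then have "subseq d (concat (map \<rho> v'))"
      using u(3) subseq_concat_map_mono subseq_order.order_trans by blast
    then show "d \<in> shadow (concat (map \<rho> v'))"
      using d(1) by (simp add: shadow_def)
  qed
  have G: "concat (map \<rho> w) \<in> lists {1..n}" "concat (map \<rho> w') \<in> lists {1..n}"
    using \<rho> by (simp_all add: concat_map_in_lists)
  have "scattered_equiv n w' w" using assms(2) by (simp add: scattered_equiv_def)
  then have "shadow (concat (map \<rho> w)) = shadow (concat (map \<rho> w'))"
    using sub[OF assms(2) G(1)] sub[OF _ G(2)] by (intro equalityI)
  with G show ?thesis by (rule shadow_determines_class)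
qed


section \<open>Hecke--Kiselman monoids above the Catalan monoid\<close>

definition catalan_step :: "nat \<Rightarrow> nat \<Rightarrow> nat" where
  "catalan_step i s = (if s = i then i - 1 else s)"

lemma pres_cong_fold_invariant:
  assumes "\<And>u v s. (u, v) \<in> R \<Longrightarrow> fold f u s = fold f v s" "(u, v) \<in> pres_cong G R"
  shows "fold f u s = fold f v s"
  using assms(2) by (induction arbitrary: s rule: pres_cong.induct) (simp_all add: assms(1))

text \<open>
  Two generators act without commuting only if their indices are consecutive, and then
  \<open>Theta_C n \<subseteq> \<Theta>\<close> puts the pair into \<open>\<Theta>\<close>.
\<close>

lemma HK_cong_fold_catalan_step:
  assumes "Theta_C n \<subseteq> \<Theta>" "\<Theta> \<subseteq> Theta_K n"
    and "(u, v) \<in> pres_cong {1..n} (HK_relations n \<Theta>)"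
  shows "fold catalan_step u s = fold catalan_step v s"
proof (rule pres_cong_fold_invariant[OF _ assms(3)])
  fix u v s assume "(u, v) \<in> HK_relations n \<Theta>"
  then show "fold catalan_step u s = fold catalan_step v s"
  proof cases
    case (idem i)
    then show ?thesis by (auto simp: catalan_step_def)
  next
    case (comm i j)
    have "i \<noteq> j + 1" "j \<noteq> i + 1"
      using comm assms(1) by (auto simp: Theta_C_def subset_iff)
    then show ?thesis using comm by (auto simp: catalan_step_def)
  next
    case (braid i j)
    then have "i < j" "j < i" using assms(2) by (auto simp: Theta_K_def)
    then show ?thesis by simp
  next
    case (arrow1 i j)
    then have "i < j" using assms(2) by (auto simp: Theta_K_def)
    then show ?thesis using arrow1 by (auto simp: catalan_step_def)
  next
    case (arrow2 i j)
    then have "i < j" using assms(2) by (auto simp: Theta_K_def)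
    then show ?thesis using arrow2 by (auto simp: catalan_step_def)
  qed
qed

text \<open>
  The generators of a block come in increasing order while the states descend, so that a
  single block moves the state by at most one.
\<close>

lemma fold_catalan_step_increasing:
  "fold catalan_step (filter P [1..<Suc m]) s = (if 0 < s \<and> s \<le> m \<and> P s then s - 1 else s)"
  by (induction m) (auto simp: catalan_step_def)

text \<open>
  The word to be searched for is \<open>rev r\<close>, so that the state \<open>s\<close>, the number of letters still
  to be found, is also the index of the generator that the next letter must contribute.
\<close>

definition search_block :: "'x list \<Rightarrow> 'x \<Rightarrow> nat list" where
  "search_block r x = filter (\<lambda>i. r ! (i - 1) = x) [1..<Suc (length r)]"

lemma fold_catalan_step_search_block:
  "s \<le> length r \<Longrightarrow>
    fold catalan_step (search_block r x) s = (if 0 < s \<and> r ! (s - 1) = x then s - 1 else s)"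
  unfolding search_block_def fold_catalan_step_increasing by auto

lemma fold_catalan_step_search:
  assumes "s \<le> length r"
  shows "fold catalan_step (concat (map (search_block r) w)) s = 0 \<longleftrightarrow> subseq (rev (take s r)) w"
  using assms
proof (induction w arbitrary: s)
  case Nil
  then show ?case by (auto dest!: list_emb_Nil2)
next
  case (Cons x w)
  show ?case
  proof (cases s)
    case 0
    then show ?thesis
      using Cons.IH[of 0] by (simp add: fold_catalan_step_search_block)
  next
    case (Suc m)
    then have "rev (take s r) = r ! m # rev (take m r)"
      using Cons.prems by (simp add: take_Suc_conv_app_nth)
    then show ?thesis
      using Cons.IH[of m] Cons.IH[of s] Cons.prems Suc
      by (auto simp: fold_catalan_step_search_block)
  qed
qed

lemma HK_cong_imp_subseq:
  fixes t :: "'x list"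
  assumes "Theta_C n \<subseteq> \<Theta>" "\<Theta> \<subseteq> Theta_K n"
    and cong: "\<And>\<rho> :: 'x \<Rightarrow> nat list. (\<And>x. \<rho> x \<in> lists {1..n}) \<Longrightarrow>
      (concat (map \<rho> w), concat (map \<rho> w')) \<in> pres_cong {1..n} (HK_relations n \<Theta>)"
    and "length t \<le> n"
  shows "subseq t w \<longleftrightarrow> subseq t w'"
proof -
  have "search_block (rev t) x \<in> lists {1..n}" for x
    using assms(4) by (auto simp: search_block_def)
  then have "(concat (map (search_block (rev t)) w), concat (map (search_block (rev t)) w'))
      \<in> pres_cong {1..n} (HK_relations n \<Theta>)"
    by (rule cong)
  from HK_cong_fold_catalan_step[OF assms(1,2) this, of "length t"] show ?thesis
    using fold_catalan_step_search[of "length t" "rev t" w]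
      fold_catalan_step_search[of "length t" "rev t" w'] by simp
qed


section \<open>Identities\<close>

text \<open>
  A homomorphism from the free semigroup is determined by the images of the letters, which can be
  chosen freely, and each image is the class of some word over the generators.
\<close>

lemma satisfies_identity_presented_monoid_iff:
  assumes w: "w \<in> carrier (free_semigroup X)" and w': "w' \<in> carrier (free_semigroup X)"
  shows "satisfies_identity X (presented_monoid G R) w w' \<longleftrightarrow>
    (\<forall>\<rho>. (\<forall>x\<in>X. \<rho> x \<in> lists G) \<longrightarrow> (concat (map \<rho> w), concat (map \<rho> w')) \<in> pres_cong G R)"
proof -
  let ?M = "presented_monoid G R" and ?c = "\<lambda>u. pres_cong G R `` {u}"
  have lists: "concat (map \<rho> u) \<in> lists G" if "\<forall>x\<in>X. \<rho> x \<in> lists G" "u \<in> lists X" for \<rho> u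
    using that by (intro concat_map_in_lists) auto
  show ?thesis
  proof
    assume sat: "satisfies_identity X ?M w w'"
    show "\<forall>\<rho>. (\<forall>x\<in>X. \<rho> x \<in> lists G) \<longrightarrow> (concat (map \<rho> w), concat (map \<rho> w')) \<in> pres_cong G R"
    proof (intro allI impI)
      fix \<rho> assume \<rho>: "\<forall>x\<in>X. \<rho> x \<in> lists G"
      have "(\<lambda>u. ?c (concat (map \<rho> u))) \<in> hom (free_semigroup X) ?M"
      proof (rule homI)
        fix u assume "u \<in> carrier (free_semigroup X)"
        then show "?c (concat (map \<rho> u)) \<in> carrier ?M"
          using lists[OF \<rho>] by (auto simp: free_semigroup_def presented_monoid_def intro: quotientI)
      next
        fix u v assume "u \<in> carrier (free_semigroup X)" "v \<in> carrier (free_semigroup X)"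
        then show "?c (concat (map \<rho> (u \<otimes>\<^bsub>free_semigroup X\<^esub> v))) =
            ?c (concat (map \<rho> u)) \<otimes>\<^bsub>?M\<^esub> ?c (concat (map \<rho> v))"
          using presented_monoid_mult[of "concat (map \<rho> u)" G "concat (map \<rho> v)" R] lists[OF \<rho>]
          by (simp add: free_semigroup_def del: in_lists_conv_set)
      qed
      then have "?c (concat (map \<rho> w)) = ?c (concat (map \<rho> w'))"
        using sat by (auto simp: satisfies_identity_def)
      moreover have "concat (map \<rho> w') \<in> lists G"
        using w' by (intro lists[OF \<rho>]) (simp add: free_semigroup_def)
      ultimately show "(concat (map \<rho> w), concat (map \<rho> w')) \<in> pres_cong G R"
        by (rule eq_equiv_class[OF _ equiv_pres_cong])
    qed
  next
    assume cong: "\<forall>\<rho>. (\<forall>x\<in>X. \<rho> x \<in> lists G) \<longrightarrow>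
      (concat (map \<rho> w), concat (map \<rho> w')) \<in> pres_cong G R"
    show "satisfies_identity X ?M w w'"
      unfolding satisfies_identity_def
    proof
      fix \<phi> assume \<phi>: "\<phi> \<in> hom (free_semigroup X) ?M"
      have "\<forall>x\<in>X. \<exists>u\<in>lists G. \<phi> [x] = ?c u"
      proof
        fix x assume "x \<in> X"
        then have "\<phi> [x] \<in> carrier ?M"
          using hom_in_carrier[OF \<phi>] by (simp add: free_semigroup_def)
        then show "\<exists>u\<in>lists G. \<phi> [x] = ?c u"
          by (simp add: presented_monoid_def quotient_def del: in_lists_conv_set)
      qed
      then obtain \<rho> where \<rho>: "\<forall>x\<in>X. \<rho> x \<in> lists G" "\<And>x. x \<in> X \<Longrightarrow> \<phi> [x] = ?c (\<rho> x)"
        by metis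
      have eval: "\<phi> u = ?c (concat (map \<rho> u))" if "u \<in> lists X" "u \<noteq> []" for u
        using that(2,1)
      proof (induction u rule: list_nonempty_induct)
        case (single x)
        then show ?case using \<rho>(2) by simp
      next
        case (cons x u)
        then have "\<phi> (x # u) = \<phi> [x] \<otimes>\<^bsub>?M\<^esub> \<phi> u"
          using hom_mult[OF \<phi>, of "[x]" u] by (simp add: free_semigroup_def)
        then show ?case
          using cons \<rho> lists[OF \<rho>(1), of u]
            presented_monoid_mult[of "\<rho> x" G "concat (map \<rho> u)" R]
          by (simp del: in_lists_conv_set)
      qed
      have "(concat (map \<rho> w), concat (map \<rho> w')) \<in> pres_cong G R" using cong \<rho>(1) by blast
      then show "\<phi> w = \<phi> w'"
        using eval w w' equiv_class_eq[OF equiv_pres_cong] by (simp add: free_semigroup_def)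
    qed
  qed
qed

theorem theorem8:
  fixes n :: nat and \<Theta> :: "(nat \<times> nat) set" and X :: "'x set"
  assumes "n \<ge> 2"
    and "Theta_C n \<subseteq> \<Theta>" and "\<Theta> \<subseteq> Theta_K n"
  shows "identities_of X (HK_monoid n \<Theta>) = J_identities X n"
proof -
  have "satisfies_identity X (HK_monoid n \<Theta>) w w' \<longleftrightarrow> scattered_equiv n w w'"
    if w: "w \<in> carrier (free_semigroup X)" "w' \<in> carrier (free_semigroup X)" for w w'
    unfolding HK_monoid_def satisfies_identity_presented_monoid_iff[OF w]
  proof
    assume cong: "\<forall>\<rho>. (\<forall>x\<in>X. \<rho> x \<in> lists {1..n}) \<longrightarrow>
      (concat (map \<rho> w), concat (map \<rho> w')) \<in> pres_cong {1..n} (HK_relations n \<Theta>)"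
    have "subseq t w \<longleftrightarrow> subseq t w'" if "length t \<le> n" for t
      by (rule HK_cong_imp_subseq[OF assms(2,3) _ that]) (use cong in blast)
    then show "scattered_equiv n w w'"
      by (auto simp: scattered_equiv_def)
  next
    assume "scattered_equiv n w w'"
    moreover have "set w \<union> set w' \<subseteq> X" using w by (auto simp: free_semigroup_def)
    ultimately show "\<forall>\<rho>. (\<forall>x\<in>X. \<rho> x \<in> lists {1..n}) \<longrightarrow>
      (concat (map \<rho> w), concat (map \<rho> w')) \<in> pres_cong {1..n} (HK_relations n \<Theta>)"
      using HK_scattered_equiv_imp_cong[OF assms(3)] by blast
  qed
  then show ?thesis
    by (auto simp: identities_of_def J_identities_def)
qed

end
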